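(* Let $p\ge 5$ be a prime, let $G$ be a cyclic group of order $p$ (written additively), and let $g$ be a generator of $G$. If $S=g^2\cdot\left(\frac{p-1}{2}g\right)\cdot\left(\frac{p+3}{2}g\right)\cdot\left((p-3)g\right)$, a sequence over $G$, then $\operatorname{ind}(S)=2$.
   Context: Let $G$ be a finite cyclic group written additively. A sequence over $G$ is an element of the free abelian monoid $\mathcal F(G)$ with basis $G$, i.e. a finite multiset of elements of $G$ written multiplicatively; $g^2$ means that the term $g$ is taken twice. Index: for each generator $g$ of $G$ one can write $S=(n_1g)\cdot\ldots\cdot(n_lg)$ with unique $n_1,\ldots,n_l\in[1,\operatorname{ord}(g)]$, and one sets $\|S\|_g=\frac{n_1+\cdots+n_l}{\operatorname{ord}(g)}$; then $\operatorname{ind}(S)=\min\{\|S\|_g : g\in G,\ G=\langle g\rangle\}$. *)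

theory Defs
  imports Complex_Main "HOL-Algebra.Elementary_Groups" "HOL-Algebra.Multiplicative_Group"
    "HOL-Library.Multiset" "HOL-Computational_Algebra.Primes"
begin

(* Groups are HOL-Algebra groups, whose notation is multiplicative: the additive multiple n g
   of the mathematical text is g [^] n here.  A sequence over G is a finite multiset of elements
   of the carrier. *)

definition generators :: "('a, 'b) monoid_scheme \<Rightarrow> 'a set" where
  "generators G = {h \<in> carrier G. generate G {h} = carrier G}"

(* The unique n in [1, ord h] with x = n h; the neutral element gets coefficient ord h, not 0. *)
definition coefficient :: "('a, 'b) monoid_scheme \<Rightarrow> 'a \<Rightarrow> 'a \<Rightarrow> nat" where
  "coefficient G h x = (THE n. n \<in> {1..group.ord G h} \<and> x = h [^]\<^bsub>G\<^esub> n)"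

definition seq_norm :: "('a, 'b) monoid_scheme \<Rightarrow> 'a \<Rightarrow> 'a multiset \<Rightarrow> rat" where
  "seq_norm G h S = of_nat (\<Sum>x\<in>#S. coefficient G h x) / of_nat (group.ord G h)"

(* Min is meaningful since a finite cyclic group has finitely many, and at least one, generators. *)
definition index :: "('a, 'b) monoid_scheme \<Rightarrow> 'a multiset \<Rightarrow> rat" where
  "index G S = Min ((\<lambda>h. seq_norm G h S) ` generators G)"

end

theory Submission
  imports Defs "HOL-Number_Theory.Cong"
begin

text \<open>
  With respect to the generator \<open>g\<close> the coefficients of \<open>S\<close> are the exponents
  \<open>1, 1, (p - 1)/2, (p + 3)/2, p - 3\<close>, which add up to \<open>2 * p\<close>.  So \<open>g\<close> attains the value 2, and it
  remains to see that no generator does better.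

  For an arbitrary generator \<open>h\<close>, let \<open>m\<close> be the coefficient of \<open>g\<close>.  Passing from \<open>g\<close> to \<open>h\<close>
  multiplies every coefficient by \<open>m\<close> modulo \<open>p\<close> (lemma \<open>coefficient_pow_cong\<close>).  Hence the
  coefficient sum is again a positive multiple of \<open>p\<close>, and the only question is whether it can be
  \<open>p\<close> itself.  Writing \<open>a, b, c\<close> for the coefficients of the last three terms, one has
  \<open>2 * a \<equiv> -m\<close> and \<open>c \<equiv> -3 * m\<close>.  If the sum were \<open>p\<close>, the small size of the coefficients would
  turn the first congruence into the equation \<open>2 * a + m = p\<close>; the remaining room is then too small
  for \<open>c\<close> to satisfy the second one (lemma \<open>residue_sum_ge_twice_modulus\<close>).
\<close>

context group
begin

lemma nat_pow_eq_iff_cong: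
  fixes m n :: nat
  assumes "x \<in> carrier G"
  shows "x [^] m = x [^] n \<longleftrightarrow> [m = n] (mod ord x)"
  using int_pow_eq[OF assms, of "int n" "int m"]
  by (auto simp: int_pow_int cong_iff_dvd_diff simp flip: cong_int_iff)

lemma ord_generator:
  assumes "h \<in> generators G"
  shows "ord h = order G"
  using assms by (simp add: generators_def generate_pow_card order_def)

lemma coefficient_pow:
  assumes "h \<in> carrier G" and "n \<in> {1..ord h}"
  shows "coefficient G h (h [^] n) = n"
  unfolding coefficient_def
proof (rule the_equality)
  fix k assume "k \<in> {1..ord h} \<and> h [^] n = h [^] k"
  then show "k = n"
    using inj_onD[OF ord_inj'[OF assms(1)]] assms(2) by metis
qed (use assms in auto)

lemma coefficient_generator:
  assumes "finite (carrier G)" and h: "h \<in> generators G" and x: "x \<in> carrier G"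
  shows "coefficient G h x \<in> {1..ord h}" and "h [^] coefficient G h x = x"
proof -
  have hG: "h \<in> carrier G" using h by (simp add: generators_def)
  have pos: "ord h > 0"
    using ord_ge_1[OF assms(1) hG] by simp
  obtain k :: nat where k: "x = h [^] k"
    using h x generate_pow_nat[OF hG] pos by (auto simp: generators_def)
  \<comment> \<open>A multiple of the order is represented by the order itself, not by 0.\<close>
  define n where "n = (if k mod ord h = 0 then ord h else k mod ord h)"
  have n: "n \<in> {1..ord h}"
    using pos by (auto simp: n_def Suc_le_eq less_imp_le)
  have "[k = n] (mod ord h)"
    by (auto simp: n_def cong_def)
  then have xn: "x = h [^] n"
    using nat_pow_eq_iff_cong[OF hG] k by blast
  then have "coefficient G h x = n"
    using coefficient_pow[OF hG n] by simp
  with n xn show "coefficient G h x \<in> {1..ord h}" and "h [^] coefficient G h x = x"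
    by simp_all
qed

text \<open>Change of generator: both sides are exponents of \<open>h\<close> that yield \<open>g [^] n\<close>.\<close>

lemma coefficient_pow_cong:
  fixes n :: nat
  assumes "finite (carrier G)" and h: "h \<in> generators G" and g: "g \<in> carrier G"
  shows "[coefficient G h (g [^] n) = n * coefficient G h g] (mod ord h)"
proof -
  have hG: "h \<in> carrier G" using h by (simp add: generators_def)
  have "h [^] (n * coefficient G h g) = (h [^] coefficient G h g) [^] n"
    using hG by (simp add: nat_pow_pow mult.commute)
  also have "\<dots> = h [^] coefficient G h (g [^] n)"
    using coefficient_generator(2)[OF assms(1) h] g by simp
  finally show ?thesis
    using nat_pow_eq_iff_cong[OF hG] by metis
qed

end

text \<open>
  A smaller sum would be \<open>p\<close>.  Then \<open>2 * m + a < p\<close> leaves only \<open>2 * a + m = p\<close> for the first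
  divisibility, so that \<open>2 * (2 * m + a + c) = p + 3 * m + 2 * c\<close>.  The left-hand side is below
  \<open>2 * p\<close>, which puts \<open>c + 3 * m\<close> strictly between \<open>0\<close> and \<open>p\<close>.
\<close>

lemma residue_sum_ge_twice_modulus:
  fixes p m a b c :: nat
  assumes "m > 0" and "b > 0"
    and am: "p dvd 2 * a + m" and cm: "p dvd c + 3 * m" and sum: "p dvd 2 * m + a + b + c"
  shows "2 * p \<le> 2 * m + a + b + c"
proof (rule ccontr)
  assume *: "\<not> ?thesis"
  obtain k where k: "2 * m + a + b + c = p * k" using sum by (elim dvdE)
  with * assms(1) have "k < 2" "k > 0"
    by (auto simp: mult.commute[of p] not_le intro: gr0I)
  then have total: "2 * m + a + b + c = p" using k by (simp add: less_2_cases_iff)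
  obtain j where j: "2 * a + m = p * j" using am by (elim dvdE)
  have "p * j < p * 2" "p * j > 0" using j total assms(1,2) by linarith+
  then have "j = 1" by (auto simp: less_2_cases_iff)
  then have "2 * a + m = p" using j by simp
  then have "c + 3 * m < p" using total assms(2) by linarith
  moreover have "p \<le> c + 3 * m" using cm assms(1) by (simp add: dvd_imp_le)
  ultimately show False by simp
qed

theorem proposition2p2:
  fixes G :: "('a, 'b) monoid_scheme" and g :: 'a and p :: nat and S :: "'a multiset"
  assumes "prime p" and "p \<ge> 5"
    and "group G" and "cyclic_group G" and "order G = p"
    and "g \<in> generators G"
    and "S = {#g, g, g [^]\<^bsub>G\<^esub> ((p - 1) div 2), g [^]\<^bsub>G\<^esub> ((p + 3) div 2), g [^]\<^bsub>G\<^esub> (p - 3)#}"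
  shows "index G S = 2"
proof -
  interpret group G by fact
  obtain q where q: "p = 2 * q + 1"
    using prime_odd_nat[OF assms(1)] assms(2) by (auto elim: oddE)
  then have "q \<ge> 2" using assms(2) by simp
  have exponents: "(p - 1) div 2 = q" "(p + 3) div 2 = q + 2"
    using q by simp_all
  have fin: "finite (carrier G)"
    using assms(2,5) order_gt_0_iff_finite by simp
  have gG: "g \<in> carrier G" using assms(6) by (simp add: generators_def)
  have S: "S = {#g, g, g [^]\<^bsub>G\<^esub> q, g [^]\<^bsub>G\<^esub> (q + 2), g [^]\<^bsub>G\<^esub> (p - 3)#}"
    using assms(7) unfolding exponents .
  have "seq_norm G g S = 2"
  proof -
    have coeff: "coefficient G g (g [^]\<^bsub>G\<^esub> n) = n" if "n \<in> {1..p}" for n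
      using coefficient_pow[OF gG] ord_generator[OF assms(6)] assms(5) that by simp
    have "coefficient G g g = 1"
      using coeff[of 1] gG assms(2) by simp
    moreover have "coefficient G g (g [^]\<^bsub>G\<^esub> q) = q"
      "coefficient G g (g [^]\<^bsub>G\<^esub> (q + 2)) = q + 2"
      "coefficient G g (g [^]\<^bsub>G\<^esub> (p - 3)) = p - 3"
      by (rule coeff, use assms(2) q in force)+
    ultimately have "(\<Sum>x\<in>#S. coefficient G g x) = 1 + (1 + (q + (q + 2 + (p - 3))))"
      unfolding S by (simp only: image_mset_add_mset image_mset_empty sum_mset.add_mset
          sum_mset.empty add_0_right)
    also have "\<dots> = 2 * p"
      using q assms(2) by linarith
    finally have "(\<Sum>x\<in>#S. coefficient G g x) = 2 * p" .
    then show ?thesis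
      using ord_generator[OF assms(6)] assms(2,5) by (simp add: seq_norm_def)
  qed
  moreover have "2 \<le> seq_norm G h S" if h: "h \<in> generators G" for h
  proof -
    have ord: "ord h = p" using ord_generator[OF h] assms(5) by simp
    define m where "m = coefficient G h g"
    define a where "a = coefficient G h (g [^]\<^bsub>G\<^esub> q)"
    define b where "b = coefficient G h (g [^]\<^bsub>G\<^esub> (q + 2))"
    define c where "c = coefficient G h (g [^]\<^bsub>G\<^esub> (p - 3))"
    have "m > 0" "b > 0"
      using coefficient_generator(1)[OF fin h gG]
        coefficient_generator(1)[OF fin h nat_pow_closed[OF gG, of "q + 2"]]
      by (simp_all add: m_def b_def)
    have a: "[a = q * m] (mod p)" and b: "[b = (q + 2) * m] (mod p)"
      and c: "[c = (p - 3) * m] (mod p)"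
      unfolding a_def b_def c_def m_def ord[symmetric]
      by (intro coefficient_pow_cong[OF fin h gG])+
    have "[2 * a + m = 2 * (q * m) + m] (mod p)"
      by (intro cong_add cong_mult a cong_refl)
    also have "2 * (q * m) + m = p * m" by (simp add: q algebra_simps)
    finally have am: "p dvd 2 * a + m" by (simp add: cong_dvd_iff)
    have "[c + 3 * m = (p - 3) * m + 3 * m] (mod p)"
      by (intro cong_add c cong_refl)
    also have "(p - 3) * m + 3 * m = p * m"
      using assms(2) by (simp flip: add_mult_distrib)
    finally have cm: "p dvd c + 3 * m" by (simp add: cong_dvd_iff)
    have "[2 * m + a + b + c = 2 * m + q * m + (q + 2) * m + (p - 3) * m] (mod p)"
      by (intro cong_add a b c cong_refl)
    also have "2 * m + q * m + (q + 2) * m + (p - 3) * m = (2 + q + (q + 2) + (p - 3)) * m"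
      by (simp only: add_mult_distrib)
    also have "2 + q + (q + 2) + (p - 3) = 2 * p"
      using q assms(2) by simp
    finally have "p dvd 2 * m + a + b + c" by (simp add: cong_dvd_iff)
    then have "2 * p \<le> 2 * m + a + b + c"
      by (rule residue_sum_ge_twice_modulus[OF \<open>m > 0\<close> \<open>b > 0\<close> am cm])
    also have "\<dots> = (\<Sum>x\<in>#S. coefficient G h x)"
      by (simp add: S m_def a_def b_def c_def)
    finally have "of_nat (2 * p) \<le> (of_nat (\<Sum>x\<in>#S. coefficient G h x) :: rat)"
      by (simp only: of_nat_le_iff)
    then show ?thesis
      using assms(2) by (simp add: seq_norm_def ord pos_le_divide_eq)
  qed
  moreover have "finite (generators G)"
    using fin by (simp add: generators_def)
  ultimately show ?thesis
    unfolding index_def using assms(6) by (intro Min_eqI) (auto intro: rev_image_eqI)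
qed

end
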